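(* Let $\ell$ and $n$ be nonnegative integers and let $b,q$ be nonzero complex numbers such that no zero factor appears in any denominator occurring in the identity below. Then $$\sum_{k=0}^{n}\frac{1}{(q^{2-n}b;q^3)_k}\,\frac{(q^{-n};q)_k(\sqrt b;q)_k(-\sqrt b;q)_k(\sqrt{qb};q)_k(-\sqrt{qb};q)_k}{(q;q)_k(q^\ell b;q)_k}\,q^{(1+\ell)k}$$ $$=\frac{(q^{1-2n}/b;q)_n}{(q^{1-2n}/b;q^3)_n}\sum_{i=0}^{\ell}(-1)^n\,\frac{q^{\{(4+4n+6\ell-6i)i-n-n^2\}/6}}{b^{(n+2i)/3}}\,\frac{q-q^{2i}b}{q-b}\,\frac{(q^{-\ell};q)_i(q^{-n};q)_i(b/q;q)_i}{(q;q)_i(q^\ell b;q)_i(q^{1-n-i}/b;q)_i}\cdot\frac{(q;q^3)_{\frac{n-i}{3}}(q^2;q^3)_{\frac{n-i}{3}}}{(q^{2-2n}/b;q^3)_{\frac{n-i}{3}}(q^{3-2n}/b;q^3)_{\frac{n-i}{3}}}\,\chi(n-i).$$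
   Context: For complex $x,q$ and an integer $m$, the $q$-shifted factorial is $(x;q)_m=\prod_{j=0}^{m-1}(1-xq^j)$ for $m>0$, $(x;q)_0=1$, and $(x;q)_m=1/\prod_{j=m}^{-1}(1-xq^j)$ for $m<0$; $(x;q^3)_m$ is the same with $q$ replaced by $q^3$. For an integer $N$, $\chi(N)=1$ if $3\mid N$ and $\chi(N)=0$ otherwise; a summand containing $\chi(n-i)=0$ is understood to be $0$, so only indices $i$ with $(n-i)/3\in\mathbb Z$ contribute (and for these the exponents of $q$ and $b$ are integers). $\sqrt b$ and $\sqrt{qb}$ denote any fixed square roots of $b$ and $qb$. *)

theory Defs
  imports Complex_Main
begin

text \<open>
  For \<open>m < 0\<close> the symbol is itself a reciprocal. Since \<open>1 / 0 = 0\<close>, the formula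
  \<open>qpoch x q m \<noteq> 0\<close> says, for either sign of \<open>m\<close>, that none of the factors
  \<open>1 - x * q powi j\<close> occurring in the symbol is zero.
\<close>

definition qpoch :: "complex \<Rightarrow> complex \<Rightarrow> int \<Rightarrow> complex" where
  "qpoch x q m =
     (if m \<ge> 0 then \<Prod>j = 0..m - 1. 1 - x * q powi j
      else 1 / (\<Prod>j = m..-1. 1 - x * q powi j))"

text \<open>
  For \<open>m \<ge> 0\<close> the range of \<open>j\<close> is empty and the condition is vacuous.
\<close>

definition qpoch_defined :: "complex \<Rightarrow> complex \<Rightarrow> int \<Rightarrow> bool" where
  "qpoch_defined x q m \<longleftrightarrow> (\<forall>j\<in>{m..-1}. 1 - x * q powi j \<noteq> 0)"

definition chi :: "int \<Rightarrow> complex" where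
  "chi N = (if 3 dvd N then 1 else 0)"

end

theory Submission
  imports Defs
begin

text \<open>
  The four square-root factors multiply to \<open>(b;q)\<^sub>2\<^sub>k\<close>. With \<open>X = q\<^sup>l\<close>, the limit
  \<open>d \<rightarrow> 0\<close> of the terminating very-well-poised \<open>\<^sub>6\<phi>\<^sub>5\<close> sum with \<open>a = b/q\<close> expands
  \<open>X\<^sup>k (b;q)\<^sub>2\<^sub>k / (X b;q)\<^sub>k\<close> over \<open>i \<le> k\<close>. Exchanging the two summations leaves inner
  sums over \<open>j = k - i\<close>, each an instance \<open>S\<^sub>N(B)\<close> of the case \<open>l = 0\<close> with
  \<open>N = n - i\<close> and \<open>B = q\<^sup>2\<^sup>i b\<close>. For fixed \<open>B\<close>, telescoping gives a two-term recurrence between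
  \<open>S\<^sub>N\<^sub>+\<^sub>3(B)\<close> and \<open>S\<^sub>N(B)\<close>, so \<open>S\<^sub>N(B)\<close> vanishes unless \<open>3\<close> divides \<open>N\<close>, and
  \<open>S\<^sub>3\<^sub>m(B) = (q;q\<^sup>3)\<^sub>m (q\<^sup>2;q\<^sup>3)\<^sub>m / ((q/B;q\<^sup>3)\<^sub>m (q\<^sup>2B;q\<^sup>3)\<^sub>m)\<close>.
\<close>

subsection \<open>Finite \<open>q\<close>-shifted factorials\<close>

definition qpochhammer :: "'a::comm_ring_1 \<Rightarrow> 'a \<Rightarrow> nat \<Rightarrow> 'a" where
  "qpochhammer x q n = (\<Prod>j<n. 1 - x * q ^ j)"

lemma qpochhammer_0 [simp]: "qpochhammer x q 0 = 1"
  by (simp add: qpochhammer_def)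

lemma qpochhammer_Suc: "qpochhammer x q (Suc n) = qpochhammer x q n * (1 - x * q ^ n)"
  by (simp add: qpochhammer_def)

lemma qpochhammer_add:
  "qpochhammer x q (m + n) = qpochhammer x q m * qpochhammer (x * q ^ m) q n"
  by (induction n) (simp_all add: qpochhammer_Suc power_add algebra_simps)

lemma qpochhammer_rec: "qpochhammer x q (Suc n) = (1 - x) * qpochhammer (x * q) q n"
  using qpochhammer_add[of x q 1 n] by (simp add: qpochhammer_Suc)

lemma qpochhammer_shift_two:
  "(1 - x) * qpochhammer (x * q) q (Suc n)
     = qpochhammer x q n * ((1 - x * q ^ n) * (1 - x * q ^ Suc n))"
  by (metis qpochhammer_rec qpochhammer_Suc mult.assoc)

lemma qpochhammer_multisection:
  "qpochhammer x q (r * m) = (\<Prod>s<r. qpochhammer (x * q ^ s) (q ^ r) m)"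
proof (induction m)
  case (Suc m)
  have "qpochhammer x q (r * Suc m) = qpochhammer x q (r * m) * qpochhammer (x * q ^ (r * m)) q r"
    using qpochhammer_add[of x q "r * m" r] by (simp add: add.commute)
  also have "qpochhammer (x * q ^ (r * m)) q r = (\<Prod>s<r. 1 - x * q ^ s * (q ^ r) ^ m)"
    by (simp add: qpochhammer_def mult_ac flip: power_mult)
  finally show ?case
    by (simp add: Suc.IH qpochhammer_Suc prod.distrib)
qed simp

lemma qpochhammer_mult_minus:
  "qpochhammer x q n * qpochhammer (- x) q n = qpochhammer (x\<^sup>2) (q\<^sup>2) n"
proof -
  have "(1 - x * q ^ j) * (1 - - x * q ^ j) = 1 - x\<^sup>2 * (q\<^sup>2) ^ j" for j
    by (simp add: algebra_simps power2_eq_square power_mult_distrib)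
  then show ?thesis
    by (simp add: qpochhammer_def flip: prod.distrib)
qed

lemma qpochhammer_square_roots:
  assumes "s\<^sup>2 = b" "t\<^sup>2 = q * b"
  shows "qpochhammer s q k * qpochhammer (- s) q k * qpochhammer t q k * qpochhammer (- t) q k
     = qpochhammer b q (2 * k)"
proof -
  have "qpochhammer b q (2 * k) = qpochhammer b (q\<^sup>2) k * qpochhammer (q * b) (q\<^sup>2) k"
    using qpochhammer_multisection[of b q 2 k] by (simp add: lessThan_nat_numeral mult.commute)
  then show ?thesis
    by (simp add: mult.assoc qpochhammer_mult_minus assms flip: mult.assoc[of "qpochhammer s q k"])
qed

lemma qpochhammer_eq_0_iff:
  fixes x :: "'a::idom"
  shows "qpochhammer x q n = 0 \<longleftrightarrow> (\<exists>j<n. x * q ^ j = 1)"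
  by (auto simp: qpochhammer_def)

lemma qpochhammer_neq_0_mono:
  fixes x :: "'a::idom"
  shows "qpochhammer x q n \<noteq> 0 \<Longrightarrow> m \<le> n \<Longrightarrow> qpochhammer x q m \<noteq> 0"
  by (meson order_less_le_trans qpochhammer_eq_0_iff)

lemma qpochhammer_inverse_power_eq_0:
  fixes q :: "'a::field"
  assumes "q \<noteq> 0" "n < k"
  shows "qpochhammer (1 / q ^ n) q k = 0"
  using assms by (auto simp: qpochhammer_eq_0_iff)

lemma qpochhammer_reverse:
  fixes w p :: "'a::field"
  assumes "w \<noteq> 0" "p \<noteq> 0"
  shows "qpochhammer w p k = (- w) ^ k * p ^ (k choose 2) * qpochhammer (p / (w * p ^ k)) p k"
proof (induction k)
  case (Suc k)
  have "1 - w * p ^ k = - w * p ^ k * (1 - 1 / (w * p ^ k))"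
    using assms by (simp add: field_simps)
  moreover have "qpochhammer (p / (w * p ^ Suc k)) p (Suc k)
      = (1 - 1 / (w * p ^ k)) * qpochhammer (p / (w * p ^ k)) p k"
    using assms by (simp add: qpochhammer_rec)
  ultimately show ?case
    by (simp add: qpochhammer_Suc Suc.IH numeral_2_eq_2 power_add mult_ac)
qed (simp add: numeral_2_eq_2)

subsection \<open>The cubic sum\<close>

definition cubic_denominator :: "'a::field \<Rightarrow> 'a \<Rightarrow> 'a \<Rightarrow> nat \<Rightarrow> 'a" where
  "cubic_denominator q z b j = qpochhammer (q\<^sup>2 * b / z) (q ^ 3) j"

lemma cubic_denominator_neq_0_mono:
  "cubic_denominator q z b n \<noteq> 0 \<Longrightarrow> m \<le> n \<Longrightarrow> cubic_denominator q z b m \<noteq> 0"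
  unfolding cubic_denominator_def by (rule qpochhammer_neq_0_mono)

definition cubic_term :: "'a::field \<Rightarrow> 'a \<Rightarrow> 'a \<Rightarrow> nat \<Rightarrow> 'a" where
  "cubic_term q z b j = qpochhammer (1 / z) q j * qpochhammer (b * q ^ j) q j * q ^ j
     / (cubic_denominator q z b j * qpochhammer q q j)"

definition cubic_sum :: "'a::field \<Rightarrow> nat \<Rightarrow> 'a \<Rightarrow> 'a" where
  "cubic_sum q n b = (\<Sum>j\<le>n. cubic_term q (q ^ n) b j)"

lemma sum_cubic_term_eq_cubic_sum:
  assumes "q \<noteq> 0" "n < m"
  shows "(\<Sum>j<m. cubic_term q (q ^ n) b j) = cubic_sum q n b"
  unfolding cubic_sum_def
  by (rule sum.mono_neutral_right)
    (use assms in \<open>auto simp: cubic_term_def qpochhammer_inverse_power_eq_0\<close>)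

lemma cubic_denominator_Suc:
  fixes q z b :: "'a::field"
  assumes "z \<noteq> 0"
  shows "z * cubic_denominator q z b (Suc j)
     = cubic_denominator q z b j * (z - q\<^sup>2 * b * (q ^ j) ^ 3)"
  using assms by (simp add: cubic_denominator_def qpochhammer_Suc field_simps flip: power_mult)

lemma cubic_term_Suc:
  fixes q z b :: "'a::field"
  assumes "z \<noteq> 0" and qq_nz: "qpochhammer q q (Suc j) \<noteq> 0"
    and den_nz: "cubic_denominator q z b (Suc j) \<noteq> 0"
  defines "y \<equiv> q ^ j"
  shows "cubic_term q z b (Suc j) * ((1 - q * y) * (1 - b * y)) * (z - q\<^sup>2 * b * y ^ 3)
       = cubic_term q z b j * (q * (z - y) * ((1 - b * y\<^sup>2) * (1 - q * b * y\<^sup>2)))"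
proof -
  define d where "d = z - q\<^sup>2 * b * y ^ 3"
  have den: "cubic_denominator q z b (Suc j) = cubic_denominator q z b j * d / z"
      "qpochhammer q q (Suc j) = qpochhammer q q j * (1 - q * y)"
    using cubic_denominator_Suc[OF \<open>z \<noteq> 0\<close>, of q b j] \<open>z \<noteq> 0\<close>
    by (simp_all add: d_def y_def qpochhammer_Suc field_simps)
  have nz: "d \<noteq> 0" "1 - q * y \<noteq> 0"
      "cubic_denominator q z b j \<noteq> 0" "qpochhammer q q j \<noteq> 0"
    using den_nz qq_nz unfolding den by auto
  have num: "(1 - b * y) * qpochhammer (b * q ^ Suc j) q (Suc j)
      = qpochhammer (b * y) q j * ((1 - b * y\<^sup>2) * (1 - q * b * y\<^sup>2))"
    using qpochhammer_shift_two[of "b * y" q j] by (simp add: y_def power2_eq_square mult_ac)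
  have top: "z * qpochhammer (1 / z) q (Suc j) = qpochhammer (1 / z) q j * (z - y)"
    using \<open>z \<noteq> 0\<close> by (simp add: y_def qpochhammer_Suc field_simps)
  have "cubic_term q z b (Suc j) * ((1 - q * y) * (1 - b * y)) * d
      = (z * qpochhammer (1 / z) q (Suc j))
        * ((1 - b * y) * qpochhammer (b * q ^ Suc j) q (Suc j)) * (q * y)
        / (cubic_denominator q z b j * qpochhammer q q j)"
    unfolding cubic_term_def den using nz \<open>z \<noteq> 0\<close> by (simp add: y_def)
  also have "\<dots> = cubic_term q z b j * (q * (z - y) * ((1 - b * y\<^sup>2) * (1 - q * b * y\<^sup>2)))"
    unfolding num top cubic_term_def by (simp add: y_def mult_ac)
  finally show ?thesis by (simp add: d_def)
qed

lemma cubic_term_shift: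
  fixes q z b :: "'a::field"
  assumes "q \<noteq> 0" "z \<noteq> 0" and den_nz: "cubic_denominator q z b (Suc j) \<noteq> 0"
  defines "y \<equiv> q ^ j"
  shows "(z - 1) * (z - q) * (z - q\<^sup>2) * (z - q\<^sup>2 * b * y ^ 3) * cubic_term q (z / q ^ 3) b j
       = (z - y) * (z - q * y) * (z - q\<^sup>2 * y) * (z - q\<^sup>2 * b) * cubic_term q z b j"
proof -
  define w where "w = cubic_denominator q z b j"
  define w' where "w' = cubic_denominator q (z / q ^ 3) b j"
  have den_last: "z * cubic_denominator q z b (Suc j) = w * (z - q\<^sup>2 * b * y ^ 3)"
    unfolding w_def y_def by (rule cubic_denominator_Suc) fact
  have den_first: "z * cubic_denominator q z b (Suc j) = (z - q\<^sup>2 * b) * w'"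
    using \<open>z \<noteq> 0\<close> by (simp add: w'_def cubic_denominator_def qpochhammer_rec field_simps)
  have nz: "w \<noteq> 0" "w' \<noteq> 0"
    using den_nz den_last den_first \<open>z \<noteq> 0\<close> by auto
  have "qpochhammer (1 / z) q (Suc (Suc (Suc j)))
      = (1 - 1 / z) * (1 - q / z) * (1 - q\<^sup>2 / z) * qpochhammer (1 / (z / q ^ 3)) q j"
    by (simp add: qpochhammer_rec power2_eq_square power3_eq_cube mult.assoc)
  moreover have "qpochhammer (1 / z) q (Suc (Suc (Suc j)))
      = qpochhammer (1 / z) q j * ((1 - y / z) * (1 - q * y / z) * (1 - q\<^sup>2 * y / z))"
    by (simp add: qpochhammer_Suc y_def power2_eq_square mult_ac)
  ultimately have num: "(z - 1) * (z - q) * (z - q\<^sup>2) * qpochhammer (1 / (z / q ^ 3)) q j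
      = (z - y) * (z - q * y) * (z - q\<^sup>2 * y) * qpochhammer (1 / z) q j"
    using \<open>z \<noteq> 0\<close> by (simp add: field_simps)
  define s where "s = qpochhammer (b * q ^ j) q j * q ^ j / qpochhammer q q j"
  have "(z - 1) * (z - q) * (z - q\<^sup>2) * (z - q\<^sup>2 * b * y ^ 3) * cubic_term q (z / q ^ 3) b j
      = ((z - 1) * (z - q) * (z - q\<^sup>2) * qpochhammer (1 / (z / q ^ 3)) q j) * s
        * (w * (z - q\<^sup>2 * b * y ^ 3)) / (w * w')"
    using nz by (simp add: cubic_term_def s_def w'_def mult_ac)
  also have "\<dots> = (z - y) * (z - q * y) * (z - q\<^sup>2 * y) * (z - q\<^sup>2 * b) * cubic_term q z b j"
    unfolding num den_last[symmetric] den_first using nz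
    by (simp add: cubic_term_def s_def w_def mult_ac)
  finally show ?thesis .
qed

text \<open>Found by Gosper's algorithm.\<close>

definition cubic_antidifference :: "'a::field \<Rightarrow> 'a \<Rightarrow> 'a \<Rightarrow> nat \<Rightarrow> 'a" where
  "cubic_antidifference q z b j = cubic_term q z b j * (1 - q ^ j) * (q - b * q ^ j) * z / q ^ j"

lemma cubic_antidifference_diff:
  fixes q z b :: "'a::field"
  assumes "q \<noteq> 0" "z \<noteq> 0" and qq_nz: "qpochhammer q q (Suc j) \<noteq> 0"
    and den_nz: "cubic_denominator q z b (Suc j) \<noteq> 0"
  defines "y \<equiv> q ^ j"
  defines "d \<equiv> z - q\<^sup>2 * b * y ^ 3"
  shows "d * (cubic_antidifference q z b (Suc j) - cubic_antidifference q z b j)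
      = cubic_term q z b j
        * ((z - 1) * (q - b * z) * d + b * ((z - y) * (z - q * y) * (z - q\<^sup>2 * y)))"
proof -
  define t where "t = cubic_term q z b j"
  have y_nz: "y \<noteq> 0" using \<open>q \<noteq> 0\<close> by (simp add: y_def)
  have certificate: "z * (q * (z - y) * ((1 - b * y\<^sup>2) * (1 - q * b * y\<^sup>2)))
      - (1 - y) * (q - b * y) * z * d
    = y * ((z - 1) * (q - b * z) * d + b * ((z - y) * (z - q * y) * (z - q\<^sup>2 * y)))"
    unfolding d_def by (simp add: algebra_simps power2_eq_square power3_eq_cube)
  have "cubic_antidifference q z b (Suc j)
      = z * (cubic_term q z b (Suc j) * ((1 - q * y) * (1 - b * y))) / y"
    using \<open>q \<noteq> 0\<close> by (simp add: cubic_antidifference_def y_def field_simps)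
  moreover have "cubic_antidifference q z b j = t * ((1 - y) * (q - b * y) * z) / y"
    by (simp add: cubic_antidifference_def t_def y_def mult_ac)
  ultimately have "d * y * (cubic_antidifference q z b (Suc j) - cubic_antidifference q z b j)
      = d * (z * (cubic_term q z b (Suc j) * ((1 - q * y) * (1 - b * y)))
        - t * ((1 - y) * (q - b * y) * z))"
    using y_nz by (simp flip: diff_divide_distrib)
  also have "\<dots> = z * (cubic_term q z b (Suc j) * ((1 - q * y) * (1 - b * y)) * d)
        - t * ((1 - y) * (q - b * y) * z * d)"
    by (simp only: right_diff_distrib mult_ac)
  also have "\<dots> = t * (z * (q * (z - y) * ((1 - b * y\<^sup>2) * (1 - q * b * y\<^sup>2)))
        - (1 - y) * (q - b * y) * z * d)"
    using cubic_term_Suc[OF \<open>z \<noteq> 0\<close> qq_nz den_nz]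
    by (simp only: d_def y_def t_def right_diff_distrib mult_ac)
  finally show ?thesis
    using y_nz unfolding certificate by (simp add: t_def)
qed

lemma cubic_term_telescope:
  fixes q z b :: "'a::field"
  assumes "q \<noteq> 0" "z \<noteq> 0" "qpochhammer q q (Suc j) \<noteq> 0"
    and den_nz: "cubic_denominator q z b (Suc j) \<noteq> 0"
  shows "(z - 1) * (q - b * z) * (z - q\<^sup>2 * b) * cubic_term q z b j
      + b * (z - 1) * (z - q) * (z - q\<^sup>2) * cubic_term q (z / q ^ 3) b j
    = (z - q\<^sup>2 * b) * (cubic_antidifference q z b (Suc j) - cubic_antidifference q z b j)"
    (is "?p * _ * ?t + b * _ * _ * _ * ?t' = _ * ?\<Delta>")
proof -
  define y where "y = q ^ j"
  define d where "d = z - q\<^sup>2 * b * y ^ 3"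
  define c where "c = (z - y) * (z - q * y) * (z - q\<^sup>2 * y)"
  have "d \<noteq> 0"
    using den_nz cubic_denominator_Suc[OF \<open>z \<noteq> 0\<close>, of q b j] \<open>z \<noteq> 0\<close> by (auto simp: d_def y_def)
  have "d * (?p * (z - q\<^sup>2 * b) * ?t + b * (z - 1) * (z - q) * (z - q\<^sup>2) * ?t')
      = ?p * (z - q\<^sup>2 * b) * ?t * d + b * ((z - 1) * (z - q) * (z - q\<^sup>2) * d * ?t')"
    by (simp only: distrib_left mult_ac)
  also have "(z - 1) * (z - q) * (z - q\<^sup>2) * d * ?t' = c * (z - q\<^sup>2 * b) * ?t"
    unfolding c_def d_def y_def by (rule cubic_term_shift) fact+
  also have "?p * (z - q\<^sup>2 * b) * ?t * d + b * (c * (z - q\<^sup>2 * b) * ?t)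
      = (z - q\<^sup>2 * b) * (?t * (?p * d + b * c))"
    by (simp only: distrib_left mult_ac)
  also have "?t * (?p * d + b * c) = d * ?\<Delta>"
    unfolding c_def d_def y_def
    by (rule cubic_antidifference_diff[symmetric]) fact+
  also have "(z - q\<^sup>2 * b) * (d * ?\<Delta>) = d * ((z - q\<^sup>2 * b) * ?\<Delta>)"
    by (rule mult.left_commute)
  finally show ?thesis
    using \<open>d \<noteq> 0\<close> by simp
qed

lemma cubic_sum_telescoped:
  fixes q b :: "'a::field"
  assumes "q \<noteq> 0" "0 < n" and qq_nz: "qpochhammer q q n \<noteq> 0"
    and den_nz: "cubic_denominator q (q ^ n) b n \<noteq> 0"
  defines "z \<equiv> q ^ n"
  shows "(q - b * z) * (z - q\<^sup>2 * b) * cubic_sum q n b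
       = - b * (z - q) * (z - q\<^sup>2) * (\<Sum>j<n. cubic_term q (z / q ^ 3) b j)"
proof -
  define G where "G = cubic_antidifference q z b"
  define p where "p = (z - 1) * (q - b * z) * (z - q\<^sup>2 * b)"
  define r where "r = b * (z - 1) * (z - q) * (z - q\<^sup>2)"
  have z_nz: "z \<noteq> 0" using \<open>q \<noteq> 0\<close> by (simp add: z_def)
  have "z \<noteq> 1"
    using qq_nz \<open>0 < n\<close> by (cases n) (auto simp: z_def qpochhammer_Suc)
  have "p * (\<Sum>j<n. cubic_term q z b j) + r * (\<Sum>j<n. cubic_term q (z / q ^ 3) b j)
      = (\<Sum>j<n. p * cubic_term q z b j + r * cubic_term q (z / q ^ 3) b j)"
    by (simp add: sum.distrib sum_distrib_left)
  also have "\<dots> = (\<Sum>j<n. (z - q\<^sup>2 * b) * (G (Suc j) - G j))"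
  proof (intro sum.cong refl)
    fix j assume "j \<in> {..<n}"
    then have "qpochhammer q q (Suc j) \<noteq> 0" "cubic_denominator q z b (Suc j) \<noteq> 0"
      using qpochhammer_neq_0_mono[OF qq_nz] cubic_denominator_neq_0_mono[OF den_nz]
      by (auto simp: z_def)
    then show "p * cubic_term q z b j + r * cubic_term q (z / q ^ 3) b j
        = (z - q\<^sup>2 * b) * (G (Suc j) - G j)"
      unfolding p_def r_def G_def by (rule cubic_term_telescope[OF \<open>q \<noteq> 0\<close> z_nz])
  qed
  also have "\<dots> = (z - q\<^sup>2 * b) * (G n - G 0)"
    by (simp add: sum_lessThan_telescope flip: sum_distrib_left)
  also have "\<dots> = - (p * cubic_term q z b n)"
    using z_nz by (simp add: G_def cubic_antidifference_def p_def flip: z_def)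
      (simp add: algebra_simps)
  finally have "p * (\<Sum>j<Suc n. cubic_term q z b j) = - r * (\<Sum>j<n. cubic_term q (z / q ^ 3) b j)"
    by (simp add: distrib_left eq_neg_iff_add_eq_0 add_ac)
  then have "(z - 1) * ((q - b * z) * (z - q\<^sup>2 * b) * cubic_sum q n b)
      = (z - 1) * (- b * (z - q) * (z - q\<^sup>2) * (\<Sum>j<n. cubic_term q (z / q ^ 3) b j))"
    by (simp add: cubic_sum_def z_def p_def r_def lessThan_Suc_atMost mult_ac)
  then show ?thesis
    using \<open>z \<noteq> 1\<close> by (simp only: mult_left_cancel right_minus_eq not_False_eq_True)
qed

lemma cubic_denominator_diff_three_neq_0:
  fixes q b :: "'a::field"
  assumes "q \<noteq> 0" and den_nz: "cubic_denominator q (q ^ (n + 3)) b (n + 3) \<noteq> 0"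
  shows "cubic_denominator q (q ^ n) b n \<noteq> 0"
proof -
  have "q\<^sup>2 * b / q ^ (n + 3) * (q ^ 3) ^ 1 = q\<^sup>2 * b / q ^ n"
    using \<open>q \<noteq> 0\<close> by (simp add: power_add)
  then have "cubic_denominator q (q ^ n) b (n + 2) \<noteq> 0"
    using den_nz qpochhammer_add[of "q\<^sup>2 * b / q ^ (n + 3)" "q ^ 3" 1 "n + 2"]
    by (auto simp: cubic_denominator_def numeral_3_eq_3)
  then show ?thesis by (rule cubic_denominator_neq_0_mono) simp
qed

lemma cubic_sum_add_three:
  fixes q b :: "'a::field"
  assumes "q \<noteq> 0" and qq_nz: "qpochhammer q q (n + 3) \<noteq> 0"
    and den_nz: "cubic_denominator q (q ^ (n + 3)) b (n + 3) \<noteq> 0"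
  shows "(q - b * q ^ (n + 3)) * (q ^ (n + 3) - q\<^sup>2 * b) * cubic_sum q (n + 3) b
       = - b * (q ^ (n + 3) - q) * (q ^ (n + 3) - q\<^sup>2) * cubic_sum q n b"
proof -
  have "q ^ (n + 3) / q ^ 3 = q ^ n"
    using \<open>q \<noteq> 0\<close> by (simp add: power_add)
  moreover have "(\<Sum>j<n + 3. cubic_term q (q ^ n) b j) = cubic_sum q n b"
    using \<open>q \<noteq> 0\<close> by (rule sum_cubic_term_eq_cubic_sum) simp
  ultimately show ?thesis
    using cubic_sum_telescoped[OF \<open>q \<noteq> 0\<close> _ qq_nz den_nz] by simp
qed

lemma cubic_sum_rec:
  fixes q b :: "'a::field"
  assumes "q \<noteq> 0" "b \<noteq> 0" and qq_nz: "qpochhammer q q (n + 3) \<noteq> 0"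
    and den_nz: "cubic_denominator q (q ^ (n + 3)) b (n + 3) \<noteq> 0"
  shows "(1 - q ^ (n + 1) / b) * (1 - b * q ^ (n + 2)) * cubic_sum q (n + 3) b
       = (1 - q ^ (n + 1)) * (1 - q ^ (n + 2)) * cubic_sum q n b"
proof -
  define c where "c = - b * q ^ 3"
  have "c \<noteq> 0" using \<open>q \<noteq> 0\<close> \<open>b \<noteq> 0\<close> by (simp add: c_def)
  have left: "(q - b * q ^ (n + 3)) * (q ^ (n + 3) - q\<^sup>2 * b)
      = c * ((1 - q ^ (n + 1) / b) * (1 - b * q ^ (n + 2)))"
    using \<open>b \<noteq> 0\<close> by (simp add: c_def field_simps power_add power2_eq_square power3_eq_cube)
  have right: "- b * (q ^ (n + 3) - q) * (q ^ (n + 3) - q\<^sup>2)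
      = c * ((1 - q ^ (n + 1)) * (1 - q ^ (n + 2)))"
    by (simp add: c_def algebra_simps power_add power2_eq_square power3_eq_cube)
  have "c * ((1 - q ^ (n + 1) / b) * (1 - b * q ^ (n + 2)) * cubic_sum q (n + 3) b)
      = c * ((1 - q ^ (n + 1)) * (1 - q ^ (n + 2)) * cubic_sum q n b)"
    using cubic_sum_add_three[OF \<open>q \<noteq> 0\<close> qq_nz den_nz] unfolding left right
    by (simp only: mult.assoc)
  then show ?thesis
    using \<open>c \<noteq> 0\<close> by (simp only: mult_left_cancel not_False_eq_True)
qed

lemma cubic_sum_three_times:
  fixes q b :: "'a::field"
  assumes "q \<noteq> 0" "b \<noteq> 0"
  shows "qpochhammer q q (3 * m) \<noteq> 0 \<Longrightarrow>
    cubic_denominator q (q ^ (3 * m)) b (3 * m) \<noteq> 0 \<Longrightarrow>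
    cubic_sum q (3 * m) b
      = qpochhammer q (q ^ 3) m * qpochhammer (q\<^sup>2) (q ^ 3) m
        / (qpochhammer (q / b) (q ^ 3) m * qpochhammer (q\<^sup>2 * b) (q ^ 3) m)"
proof (induction m)
  case 0
  then show ?case by (simp add: cubic_sum_def cubic_term_def cubic_denominator_def)
next
  case (Suc m)
  define n where "n = 3 * m"
  have n: "3 * Suc m = n + 3" by (simp add: n_def)
  note qq_nz = Suc.prems(1)[unfolded n] and den_nz = Suc.prems(2)[unfolded n]
  have IH: "cubic_sum q n b = qpochhammer q (q ^ 3) m * qpochhammer (q\<^sup>2) (q ^ 3) m
        / (qpochhammer (q / b) (q ^ 3) m * qpochhammer (q\<^sup>2 * b) (q ^ 3) m)"
    unfolding n_def
    using cubic_denominator_diff_three_neq_0[OF \<open>q \<noteq> 0\<close> den_nz] qpochhammer_neq_0_mono[OF qq_nz]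
    by (intro Suc.IH) (auto simp: n_def)
  have pow: "(q ^ 3) ^ (2 * m + 1) = q ^ (n + 3) * q ^ n"
    unfolding power_mult[symmetric] power_add[symmetric] by (simp add: n_def add.commute)
  have "q\<^sup>2 * b / q ^ (n + 3) * (q ^ 3) ^ j \<noteq> 1" if "j < n + 3" for j
    using den_nz that by (auto simp: cubic_denominator_def qpochhammer_eq_0_iff)
  from this[of 0] this[of "2 * m + 1", unfolded pow]
  have "q\<^sup>2 * b / q ^ (n + 3) \<noteq> 1" "q\<^sup>2 * b / q ^ (n + 3) * (q ^ (n + 3) * q ^ n) \<noteq> 1"
    by (simp_all add: n_def)
  moreover have "q\<^sup>2 * b / q ^ (n + 3) = b / q ^ (n + 1)"
    "q\<^sup>2 * b / q ^ (n + 3) * (q ^ (n + 3) * q ^ n) = b * q ^ (n + 2)"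
    using \<open>q \<noteq> 0\<close> by (simp_all add: power_add power2_eq_square power3_eq_cube)
  ultimately have "1 - q ^ (n + 1) / b \<noteq> 0" "1 - b * q ^ (n + 2) \<noteq> 0"
    using assms by auto
  then have "cubic_sum q (n + 3) b = (1 - q ^ (n + 1)) * (1 - q ^ (n + 2)) * cubic_sum q n b
      / ((1 - q ^ (n + 1) / b) * (1 - b * q ^ (n + 2)))"
    using cubic_sum_rec[OF assms qq_nz den_nz] by (simp add: eq_divide_eq mult_ac)
  then show ?case
    unfolding IH n
    by (simp add: qpochhammer_Suc n_def power2_eq_square mult_ac flip: power_mult)
qed

lemma cubic_sum_eq_0_generic:
  fixes q b :: "'a::field"
  assumes "q \<noteq> 0"
  shows "\<not> 3 dvd n \<Longrightarrow> qpochhammer b q n \<noteq> 0 \<Longrightarrow> qpochhammer q q n \<noteq> 0 \<Longrightarrow>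
    cubic_denominator q (q ^ n) b n \<noteq> 0 \<Longrightarrow> cubic_sum q n b = 0"
proof (induction n rule: less_induct)
  case (less n)
  note qq_nz = less.prems(3) and den_nz = less.prems(4)
  define z where "z = q ^ n"
  from less.prems(1) obtain k where n: "n = Suc k"
    by (cases n) auto
  have "q - b * z = q * (1 - b * q ^ k)"
    by (simp add: z_def n algebra_simps)
  moreover have "z - q\<^sup>2 * b = z * (1 - q\<^sup>2 * b / z)"
    using \<open>q \<noteq> 0\<close> by (simp add: z_def field_simps)
  ultimately have nz: "q - b * z \<noteq> 0" "z - q\<^sup>2 * b \<noteq> 0"
    using less.prems(2) den_nz \<open>q \<noteq> 0\<close>
    by (auto simp: z_def n cubic_denominator_def qpochhammer_Suc[of b]
        qpochhammer_rec[of "q\<^sup>2 * b / _"])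
  have "n = 1 \<or> n = 2 \<or> 3 \<le> n"
    using n by linarith
  then consider (base) "z = q \<or> z = q\<^sup>2" | (step) i where "n = i + 3"
    by (auto simp: z_def add.commute dest: le_Suc_ex[of 3])
  then show ?case
  proof cases
    case base
    then have "(q - b * z) * (z - q\<^sup>2 * b) * cubic_sum q n b = 0"
      using cubic_sum_telescoped[OF \<open>q \<noteq> 0\<close> _ qq_nz den_nz] by (auto simp: z_def n)
    with nz show ?thesis by simp
  next
    case (step i)
    have "cubic_sum q i b = 0"
      using less.prems cubic_denominator_diff_three_neq_0[OF \<open>q \<noteq> 0\<close>, of i b]
        qpochhammer_neq_0_mono[of _ _ "i + 3" i]
      by (intro less.IH) (auto simp: step)
    with nz show ?thesis
      using cubic_sum_add_three[OF \<open>q \<noteq> 0\<close> qq_nz[unfolded step] den_nz[unfolded step]]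
      by (simp add: z_def step)
  qed
qed

lemma isCont_qpochhammer [continuous_intros]:
  fixes f :: "'a::real_normed_field \<Rightarrow> 'a"
  shows "isCont f x \<Longrightarrow> isCont (\<lambda>x. qpochhammer (f x) q n) x"
  unfolding qpochhammer_def by (intro continuous_intros)

lemma isCont_cubic_denominator:
  fixes q b :: "'a::real_normed_field"
  assumes "z \<noteq> 0"
  shows "isCont (\<lambda>b. cubic_denominator q z b n) b"
  unfolding cubic_denominator_def using assms by (intro continuous_intros)

lemma isCont_cubic_sum:
  fixes q b :: "'a::real_normed_field"
  assumes "q \<noteq> 0" and qq_nz: "qpochhammer q q n \<noteq> 0"
    and den_nz: "cubic_denominator q (q ^ n) b n \<noteq> 0"
  shows "isCont (cubic_sum q n) b"
  unfolding cubic_sum_def[abs_def] cubic_term_def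
  by (intro continuous_intros isCont_cubic_denominator)
    (use cubic_denominator_neq_0_mono[OF den_nz] qpochhammer_neq_0_mono[OF qq_nz] \<open>q \<noteq> 0\<close> in auto)

text \<open>The recurrence gives no information where \<open>b q\<^sup>n\<^sup>-\<^sup>1 = 1\<close>; continuity in \<open>b\<close> does.\<close>

lemma cubic_sum_eq_0:
  fixes q b :: "'a::real_normed_field"
  assumes "q \<noteq> 0" "\<not> 3 dvd n" and qq_nz: "qpochhammer q q n \<noteq> 0"
    and den_nz: "cubic_denominator q (q ^ n) b n \<noteq> 0"
  shows "cubic_sum q n b = 0"
proof -
  have "((\<lambda>b. cubic_denominator q (q ^ n) b n) \<longlongrightarrow> cubic_denominator q (q ^ n) b n) (at b)"
    using \<open>q \<noteq> 0\<close> by (intro isContD isCont_cubic_denominator) simp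
  then have "\<forall>\<^sub>F b' in at b. cubic_denominator q (q ^ n) b' n \<noteq> 0"
    using den_nz by (rule tendsto_imp_eventually_ne)
  moreover have "\<forall>\<^sub>F b' in at b. \<forall>j\<in>{..<n}. b' \<noteq> 1 / q ^ j"
    by (intro eventually_ball_finite ballI eventually_neq_at_within) simp
  then have "\<forall>\<^sub>F b' in at b. qpochhammer b' q n \<noteq> 0"
    by (rule eventually_mono) (use \<open>q \<noteq> 0\<close> in \<open>auto simp: qpochhammer_eq_0_iff field_simps\<close>)
  ultimately have "\<forall>\<^sub>F b' in at b. cubic_sum q n b' = 0"
    by eventually_elim (rule cubic_sum_eq_0_generic[OF assms(1,2) _ qq_nz])
  then have "(cubic_sum q n \<longlongrightarrow> 0) (at b)"
    by (rule tendsto_eventually)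
  moreover have "(cubic_sum q n \<longlongrightarrow> cubic_sum q n b) (at b)"
    using isCont_cubic_sum[OF \<open>q \<noteq> 0\<close> qq_nz den_nz] by (rule isContD)
  ultimately show ?thesis
    by (metis LIM_unique)
qed

subsection \<open>The very-well-poised expansion\<close>

definition qbinomial :: "'a::field \<Rightarrow> nat \<Rightarrow> nat \<Rightarrow> 'a" where
  "qbinomial q n k = qpochhammer q q n / (qpochhammer q q k * qpochhammer q q (n - k))"

text \<open>
  Equals \<open>(1 - b q\<^sup>2\<^sup>i\<^sup>-\<^sup>1) (b/q;q)\<^sub>i / (1 - b/q)\<close>, in a form that stays meaningful at
  \<open>b = q\<close>.
\<close>

primrec very_well_poised_factor :: "'a::comm_ring_1 \<Rightarrow> 'a \<Rightarrow> nat \<Rightarrow> 'a" where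
  "very_well_poised_factor b q 0 = 1"
| "very_well_poised_factor b q (Suc h) = (1 - b * q ^ (2 * h + 1)) * qpochhammer b q h"

lemma very_well_poised_factor_eq:
  fixes b q :: "'a::field"
  assumes "q \<noteq> 0" "q - b \<noteq> 0"
  shows "very_well_poised_factor b q i
    = (q - q ^ (2 * i) * b) / (q - b) * qpochhammer (b / q) q i"
proof (cases i)
  case 0
  then show ?thesis using assms by simp
next
  case (Suc h)
  have "qpochhammer (b / q) q (Suc h) = (q - b) / q * qpochhammer b q h"
    using assms by (simp add: qpochhammer_rec field_simps)
  moreover have "q - q ^ (2 * Suc h) * b = q * (1 - b * q ^ (2 * h + 1))"
    by (simp add: algebra_simps)
  ultimately show ?thesis using assms Suc by simp
qed

definition expansion_term :: "'a::field \<Rightarrow> 'a \<Rightarrow> 'a \<Rightarrow> nat \<Rightarrow> nat \<Rightarrow> 'a" where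
  "expansion_term X b q i j = qbinomial q (i + j) i * very_well_poised_factor b q i
     * (X ^ i * qpochhammer (1 / X) q i)
     * qpochhammer (b * q ^ (2 * i + j)) q j * qpochhammer (X * b * q ^ i) q j"

text \<open>A WZ certificate for the recurrence in \<open>k = i + j\<close>.\<close>

primrec expansion_cert :: "'a::field \<Rightarrow> 'a \<Rightarrow> 'a \<Rightarrow> nat \<Rightarrow> nat \<Rightarrow> 'a" where
  "expansion_cert X b q 0 j = 0"
| "expansion_cert X b q (Suc h) j = qbinomial q (h + j) h * qpochhammer b q h
     * (X ^ Suc h * qpochhammer (1 / X) q (Suc h))
     * qpochhammer (b * q ^ (2 * h + j + 1)) q (Suc j) * qpochhammer (X * b * q ^ h) q j"

lemma expansion_term_0_rec:
  fixes X b q :: "'a::field"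
  assumes "X \<noteq> 0" and qq_nz: "qpochhammer q q (Suc j) \<noteq> 0"
  shows "expansion_term X b q 0 (Suc j)
     - X * ((1 - b * q ^ (2 * j)) * (1 - b * q ^ (2 * j + 1))) * expansion_term X b q 0 j
     = - expansion_cert X b q 1 j"
proof -
  define K where "K = qpochhammer (b * q ^ Suc j) q (Suc j) * qpochhammer (X * b) q j"
  have nz: "qpochhammer q q j \<noteq> 0" by (rule qpochhammer_neq_0_mono[OF qq_nz]) simp
  have succ: "expansion_term X b q 0 (Suc j) = K * (1 - X * b * q ^ j)"
    using qq_nz by (simp add: expansion_term_def qbinomial_def K_def qpochhammer_Suc[of "X * b"])
  have "qpochhammer (b * q ^ j) q j * ((1 - b * q ^ (2 * j)) * (1 - b * q ^ (2 * j + 1)))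
      = (1 - b * q ^ j) * qpochhammer (b * q ^ Suc j) q (Suc j)"
    using qpochhammer_shift_two[of "b * q ^ j" q j]
    by (simp add: mult_2 mult_2_right power_add mult_ac)
  then have current:
    "X * ((1 - b * q ^ (2 * j)) * (1 - b * q ^ (2 * j + 1))) * expansion_term X b q 0 j
      = K * (X * (1 - b * q ^ j))"
    using nz by (simp add: expansion_term_def qbinomial_def K_def mult_ac)
  have cert: "expansion_cert X b q 1 j = K * (X - 1)"
    using nz \<open>X \<noteq> 0\<close> by (simp add: qbinomial_def K_def qpochhammer_Suc[of "1 / X"] field_simps)
  show ?thesis
    unfolding succ current cert by (simp add: algebra_simps)
qed

definition expansion_common_factor :: "'a::field \<Rightarrow> 'a \<Rightarrow> 'a \<Rightarrow> nat \<Rightarrow> nat \<Rightarrow> 'a" where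
  "expansion_common_factor X b q h j
     = qpochhammer q q (h + j + 1) / (qpochhammer q q (Suc h) * qpochhammer q q (Suc j))
       * qpochhammer b q h * (X ^ Suc h * qpochhammer (1 / X) q (Suc h))
       * qpochhammer (b * q ^ (2 * h + j + 3)) q (Suc j) * qpochhammer (X * b * q ^ Suc h) q j"

lemma expansion_term_Suc_Suc:
  "expansion_term X b q (Suc h) (Suc j) = expansion_common_factor X b q h j
     * ((1 - q ^ (h + j + 2)) * (1 - b * q ^ (2 * h + 1)) * (1 - X * b * q ^ (h + j + 1)))"
proof -
  have "qbinomial q (Suc h + Suc j) (Suc h) = qpochhammer q q (h + j + 1)
      / (qpochhammer q q (Suc h) * qpochhammer q q (Suc j)) * (1 - q ^ (h + j + 2))"
    by (simp add: qbinomial_def qpochhammer_Suc[of q q "Suc (h + j)"])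
  moreover have "qpochhammer (X * b * q ^ Suc h) q (Suc j)
      = qpochhammer (X * b * q ^ Suc h) q j * (1 - X * b * q ^ (h + j + 1))"
    by (simp add: qpochhammer_Suc power_add mult_ac)
  moreover have "2 * Suc h + Suc j = 2 * h + j + 3" by simp
  ultimately show ?thesis
    unfolding expansion_term_def expansion_common_factor_def very_well_poised_factor.simps
    by (simp only: mult_ac)
qed

lemma expansion_term_Suc_mult:
  fixes X b q :: "'a::field" and h j :: nat
  assumes "qpochhammer q q (Suc j) \<noteq> 0"
  defines "k \<equiv> Suc h + j"
  shows "(1 - b * q ^ (2 * k)) * (1 - b * q ^ (2 * k + 1)) * expansion_term X b q (Suc h) j
    = expansion_common_factor X b q h j
      * ((1 - q ^ Suc j) * (1 - b * q ^ (2 * h + 1)) * (1 - b * q ^ (2 * h + j + 2)))"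
proof -
  define x where "x = b * q ^ (2 * h + j + 2)"
  have binomial: "qbinomial q k (Suc h) = qpochhammer q q (h + j + 1)
      / (qpochhammer q q (Suc h) * qpochhammer q q (Suc j)) * (1 - q ^ Suc j)"
    using assms(1) by (simp add: qbinomial_def k_def qpochhammer_Suc[of q q j])
  have x_eq: "b * q ^ (2 * Suc h + j) = x" "b * q ^ (2 * h + j + 3) = x * q"
    by (simp_all add: x_def numeral_3_eq_3)
  have "2 * k = 2 * h + j + 2 + j" by (simp add: k_def)
  then have "b * q ^ (2 * k) = x * q ^ j" "b * q ^ (2 * k + 1) = x * q ^ Suc j"
    by (simp_all only: x_def power_add power_Suc power_one_right mult_ac)
  then have shift: "qpochhammer x q j * ((1 - b * q ^ (2 * k)) * (1 - b * q ^ (2 * k + 1)))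
      = (1 - x) * qpochhammer (x * q) q (Suc j)"
    by (simp only: qpochhammer_shift_two)
  have "(1 - b * q ^ (2 * k)) * (1 - b * q ^ (2 * k + 1)) * expansion_term X b q (Suc h) j
      = qbinomial q k (Suc h) * ((1 - b * q ^ (2 * h + 1)) * qpochhammer b q h)
        * (X ^ Suc h * qpochhammer (1 / X) q (Suc h))
        * (qpochhammer x q j * ((1 - b * q ^ (2 * k)) * (1 - b * q ^ (2 * k + 1))))
        * qpochhammer (X * b * q ^ Suc h) q j"
    unfolding expansion_term_def very_well_poised_factor.simps k_def[symmetric] x_eq
    by (simp only: mult_ac)
  then show ?thesis
    unfolding shift binomial expansion_common_factor_def x_eq x_def[symmetric]
    by (simp only: mult_ac)
qed

lemma expansion_cert_Suc_Suc_right: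
  assumes "qpochhammer q q (Suc h) \<noteq> 0"
  shows "expansion_cert X b q (Suc h) (Suc j) = expansion_common_factor X b q h j
    * ((1 - q ^ Suc h) * (1 - b * q ^ (2 * h + j + 2)) * (1 - X * b * q ^ h))"
proof -
  have "qbinomial q (h + Suc j) h = qpochhammer q q (h + j + 1)
      / (qpochhammer q q (Suc h) * qpochhammer q q (Suc j)) * (1 - q ^ Suc h)"
    using assms by (simp add: qbinomial_def qpochhammer_Suc[of q q h])
  moreover have "qpochhammer (b * q ^ (2 * h + Suc j + 1)) q (Suc (Suc j))
      = (1 - b * q ^ (2 * h + j + 2)) * qpochhammer (b * q ^ (2 * h + j + 3)) q (Suc j)"
    by (simp add: qpochhammer_rec[of _ _ "Suc j"] numeral_3_eq_3 mult_ac)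
  moreover have "qpochhammer (X * b * q ^ h) q (Suc j)
      = (1 - X * b * q ^ h) * qpochhammer (X * b * q ^ Suc h) q j"
    by (simp add: qpochhammer_rec mult_ac)
  ultimately show ?thesis
    unfolding expansion_cert.simps expansion_common_factor_def by (simp only: mult_ac)
qed

lemma expansion_cert_Suc_Suc_left:
  assumes "X \<noteq> 0" "qpochhammer q q (Suc j) \<noteq> 0"
  shows "expansion_cert X b q (Suc (Suc h)) j = expansion_common_factor X b q h j
    * ((1 - q ^ Suc j) * (1 - b * q ^ h) * (X - q ^ Suc h))"
proof -
  have "qbinomial q (Suc h + j) (Suc h) = qpochhammer q q (h + j + 1)
      / (qpochhammer q q (Suc h) * qpochhammer q q (Suc j)) * (1 - q ^ Suc j)"
    using assms by (simp add: qbinomial_def qpochhammer_Suc[of q q j])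
  moreover have "X ^ Suc (Suc h) * qpochhammer (1 / X) q (Suc (Suc h))
      = X ^ Suc h * qpochhammer (1 / X) q (Suc h) * (X - q ^ Suc h)"
    using \<open>X \<noteq> 0\<close> by (simp add: qpochhammer_Suc[of _ _ "Suc h"] field_simps)
  moreover have "2 * Suc h + j + 1 = 2 * h + j + 3" by simp
  ultimately show ?thesis
    unfolding expansion_cert.simps expansion_common_factor_def qpochhammer_Suc[of b]
    by (simp only: mult_ac)
qed

lemma expansion_term_rec:
  fixes X b q :: "'a::field"
  assumes "X \<noteq> 0" and qq_nz: "qpochhammer q q (Suc (i + j)) \<noteq> 0"
  defines "k \<equiv> i + j"
  shows "expansion_term X b q i (Suc j)
     - X * ((1 - b * q ^ (2 * k)) * (1 - b * q ^ (2 * k + 1)) * expansion_term X b q i j)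
     = expansion_cert X b q i (Suc j) - expansion_cert X b q (Suc i) j"
proof (cases i)
  case 0
  then show ?thesis
    using expansion_term_0_rec[of X q j b] assms by (simp add: mult.assoc)
next
  case (Suc h)
  have nz: "qpochhammer q q (Suc h) \<noteq> 0" "qpochhammer q q (Suc j) \<noteq> 0"
    by (rule qpochhammer_neq_0_mono[OF qq_nz], simp add: Suc)+
  define y where "y = q ^ h"
  define v where "v = q ^ j"
  have pows: "q ^ (h + j + 2) = q\<^sup>2 * y * v" "q ^ (2 * h + 1) = q * y\<^sup>2"
    "q ^ (h + j + 1) = q * y * v" "q ^ (2 * h + j + 2) = q\<^sup>2 * y\<^sup>2 * v"
    "q ^ Suc h = q * y" "q ^ Suc j = q * v"
    by (simp_all add: y_def v_def power_add power2_eq_square mult_2_right mult_ac)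
  have "(1 - q\<^sup>2 * y * v) * (1 - b * (q * y\<^sup>2)) * (1 - X * b * (q * y * v))
        - X * ((1 - q * v) * (1 - b * (q * y\<^sup>2)) * (1 - b * (q\<^sup>2 * y\<^sup>2 * v)))
      = (1 - q * y) * (1 - b * (q\<^sup>2 * y\<^sup>2 * v)) * (1 - X * b * y)
        - (1 - q * v) * (1 - b * y) * (X - q * y)"
    by (simp add: algebra_simps power2_eq_square)
  then show ?thesis
    unfolding Suc k_def expansion_term_Suc_Suc expansion_term_Suc_mult[OF nz(2)]
      expansion_cert_Suc_Suc_right[OF nz(1)] expansion_cert_Suc_Suc_left[OF \<open>X \<noteq> 0\<close> nz(2)] pows
      y_def[symmetric] mult.left_commute[of X] right_diff_distrib[symmetric]
    by (simp only:)
qed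

lemma power_mult_qpochhammer_expansion:
  fixes X b q :: "'a::field"
  assumes "X \<noteq> 0"
  shows "qpochhammer q q k \<noteq> 0 \<Longrightarrow>
    X ^ k * qpochhammer b q (2 * k) = (\<Sum>i\<le>k. expansion_term X b q i (k - i))"
proof (induction k)
  case 0
  then show ?case by (simp add: expansion_term_def qbinomial_def)
next
  case (Suc k)
  have nz: "qpochhammer q q k \<noteq> 0" by (rule qpochhammer_neq_0_mono[OF Suc.prems]) simp
  define R where "R = (1 - b * q ^ (2 * k)) * (1 - b * q ^ (2 * k + 1))"
  define W where "W = (\<lambda>i. expansion_cert X b q i (Suc k - i))"
  have rec: "expansion_term X b q i (Suc k - i)
      = X * (R * expansion_term X b q i (k - i)) + (W i - W (Suc i))" if "i \<le> k" for i
  proof -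
    from that have index: "i + (k - i) = k"
      "Suc k - i = Suc (k - i)" "Suc k - Suc i = k - i" by auto
    show ?thesis
      using expansion_term_rec[OF assms, of q i "k - i" b, unfolded index(1), OF Suc.prems]
      unfolding R_def W_def index(2,3) by (simp only: diff_eq_eq add.commute)
  qed
  have last: "expansion_term X b q (Suc k) 0 = W (Suc k)"
    using Suc.prems nz
    by (simp add: expansion_term_def qbinomial_def W_def qpochhammer_Suc[of "b * _"])
  have "(\<Sum>i\<le>Suc k. expansion_term X b q i (Suc k - i))
      = X * (R * (\<Sum>i\<le>k. expansion_term X b q i (k - i))) + (\<Sum>i\<le>k. W i - W (Suc i)) + W (Suc k)"
    by (simp add: last rec sum.distrib sum_distrib_left)
  also have "\<dots> = X * (R * (X ^ k * qpochhammer b q (2 * k)))"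
    unfolding Suc.IH[OF nz] sum_telescope by (simp add: W_def)
  also have "\<dots> = X ^ Suc k * qpochhammer b q (2 * Suc k)"
    by (simp add: R_def qpochhammer_Suc mult_ac)
  finally show ?case by simp
qed

definition reduction_coeff :: "'a::field \<Rightarrow> 'a \<Rightarrow> 'a \<Rightarrow> 'a \<Rightarrow> nat \<Rightarrow> 'a" where
  "reduction_coeff X z b q i = very_well_poised_factor b q i * (X ^ i * qpochhammer (1 / X) q i)
     * qpochhammer (1 / z) q i * q ^ i
     / (qpochhammer (X * b) q i * qpochhammer q q i * cubic_denominator q z b i)"

lemma expansion_term_reduction:
  fixes X z b q :: "'a::field"
  assumes "q \<noteq> 0" "z \<noteq> 0" and qq_nz: "qpochhammer q q (i + j) \<noteq> 0"
    and Xb_nz: "qpochhammer (X * b) q (i + j) \<noteq> 0"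
  shows "qpochhammer (1 / z) q (i + j) * q ^ (i + j)
       / (cubic_denominator q z b (i + j) * qpochhammer q q (i + j)
          * qpochhammer (X * b) q (i + j)) * expansion_term X b q i j
     = reduction_coeff X z b q i * cubic_term q (z / q ^ i) (b * q ^ (2 * i)) j"
proof -
  have num: "qpochhammer (1 / z) q (i + j)
      = qpochhammer (1 / z) q i * qpochhammer (1 / (z / q ^ i)) q j"
    by (simp add: qpochhammer_add)
  have "q\<^sup>2 * b / z * (q ^ 3) ^ i = q\<^sup>2 * (b * q ^ (2 * i)) / (z / q ^ i)"
    by (simp add: power_mult_distrib power3_eq_cube mult_2_right power_add mult_ac)
  then have den: "cubic_denominator q z b (i + j)
      = cubic_denominator q z b i * cubic_denominator q (z / q ^ i) (b * q ^ (2 * i)) j"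
    by (simp only: cubic_denominator_def qpochhammer_add)
  have Xb: "qpochhammer (X * b) q (i + j)
      = qpochhammer (X * b) q i * qpochhammer (X * b * q ^ i) q j"
    by (rule qpochhammer_add)
  then have "qpochhammer (X * b * q ^ i) q j \<noteq> 0"
    using Xb_nz by auto
  then show ?thesis
    unfolding expansion_term_def reduction_coeff_def cubic_term_def qbinomial_def num den Xb
    using qq_nz by (simp add: power_add mult_ac)
qed

lemma sum_reduction_cubic_term:
  fixes X z b q :: "'a::field"
  assumes "q \<noteq> 0" "z \<noteq> 0" "X \<noteq> 0" and qq_nz: "qpochhammer q q n \<noteq> 0"
    and Xb_nz: "qpochhammer (X * b) q n \<noteq> 0"
  shows "(\<Sum>k\<le>n. qpochhammer (1 / z) q k * q ^ k
       / (cubic_denominator q z b k * qpochhammer q q k * qpochhammer (X * b) q k)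
       * (X ^ k * qpochhammer b q (2 * k)))
     = (\<Sum>i\<le>n. reduction_coeff X z b q i
         * (\<Sum>j\<le>n - i. cubic_term q (z / q ^ i) (b * q ^ (2 * i)) j))"
    (is "(\<Sum>k\<le>n. ?w k * _ k) = _")
proof -
  define g where
    "g = (\<lambda>i j. reduction_coeff X z b q i * cubic_term q (z / q ^ i) (b * q ^ (2 * i)) j)"
  have "?w k * (X ^ k * qpochhammer b q (2 * k)) = (\<Sum>i\<le>k. g i (k - i))" if "k \<le> n" for k
  proof -
    have qqk_nz: "qpochhammer q q k \<noteq> 0" and Xbk_nz: "qpochhammer (X * b) q k \<noteq> 0"
      using that qpochhammer_neq_0_mono[OF qq_nz] qpochhammer_neq_0_mono[OF Xb_nz] by auto
    have "?w k * expansion_term X b q i (k - i) = g i (k - i)" if "i \<le> k" for i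
      using expansion_term_reduction[OF assms(1,2), of i "k - i" X b]
        that qqk_nz Xbk_nz by (simp add: g_def)
    then show ?thesis
      by (simp add: power_mult_qpochhammer_expansion[OF \<open>X \<noteq> 0\<close> qqk_nz] sum_distrib_left)
  qed
  then have "(\<Sum>k\<le>n. ?w k * (X ^ k * qpochhammer b q (2 * k))) = (\<Sum>k\<le>n. \<Sum>i\<le>k. g i (k - i))"
    by (intro sum.cong) auto
  also have "\<dots> = (\<Sum>(i, j)\<in>{(i, j). i + j \<le> n}. g i j)"
    by (rule sum.triangle_reindex_eq[symmetric])
  also have "{(i, j). i + j \<le> n} = (SIGMA i:{..n}. {..n - i})"
    by auto
  also have "(\<Sum>(i, j)\<in>\<dots>. g i j) = (\<Sum>i\<le>n. \<Sum>j\<le>n - i. g i j)"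
    by (simp add: sum.Sigma)
  finally show ?thesis
    by (simp add: g_def sum_distrib_left)
qed

lemma sum_reduction_cubic_sum:
  fixes X b q :: "'a::field"
  assumes "q \<noteq> 0" "X \<noteq> 0" "qpochhammer q q n \<noteq> 0" "qpochhammer (X * b) q n \<noteq> 0"
  shows "(\<Sum>k\<le>n. qpochhammer (1 / q ^ n) q k * q ^ k
       / (cubic_denominator q (q ^ n) b k * qpochhammer q q k * qpochhammer (X * b) q k)
       * (X ^ k * qpochhammer b q (2 * k)))
     = (\<Sum>i\<le>n. reduction_coeff X (q ^ n) b q i * cubic_sum q (n - i) (b * q ^ (2 * i)))"
proof -
  have "q ^ n / q ^ i = q ^ (n - i)" if "i \<le> n" for i
    using \<open>q \<noteq> 0\<close> that by (simp add: power_diff)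
  then show ?thesis
    using sum_reduction_cubic_term[of q "q ^ n" X n b] assms
    by (simp add: cubic_sum_def)
qed

lemma cubic_denominator_reduced:
  fixes q b :: "'a::field"
  assumes "q \<noteq> 0" "i \<le> n" "cubic_denominator q (q ^ n) b n \<noteq> 0"
  shows "cubic_denominator q (q ^ (n - i)) (b * q ^ (2 * i)) (n - i) \<noteq> 0"
proof -
  from \<open>i \<le> n\<close> obtain k where n: "n = i + k" by (metis le_Suc_ex)
  have "q\<^sup>2 * b / q ^ n * (q ^ 3) ^ i = q\<^sup>2 * (b * q ^ (2 * i)) / q ^ k"
    using \<open>q \<noteq> 0\<close>
    by (simp add: n power_add power3_eq_cube power_mult_distrib mult_2_right mult_ac)
  then show ?thesis
    using assms(3) qpochhammer_add[of "q\<^sup>2 * b / q ^ n" "q ^ 3" i k]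
    by (auto simp: n cubic_denominator_def)
qed

subsection \<open>Matching the two sides\<close>

lemma qpochhammer_eq_cubed_times_trisected:
  fixes x q :: "'a::comm_ring_1"
  shows "qpochhammer x q (3 * m + i) * qpochhammer (x * q ^ (3 * m)) (q ^ 3) (i + 2 * m)
    = qpochhammer x (q ^ 3) (3 * m + i)
      * (qpochhammer (x * q ^ (3 * m)) q i
         * (qpochhammer (x * q) (q ^ 3) m * qpochhammer (x * q\<^sup>2) (q ^ 3) m))"
proof -
  have "qpochhammer x q (3 * m + i)
      = qpochhammer x (q ^ 3) m * qpochhammer (x * q) (q ^ 3) m * qpochhammer (x * q\<^sup>2) (q ^ 3) m
        * qpochhammer (x * q ^ (3 * m)) q i"
    unfolding qpochhammer_add qpochhammer_multisection
    by (simp add: lessThan_nat_numeral lessThan_Suc numeral_3_eq_3 power2_eq_square mult_ac)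
  moreover have "qpochhammer x (q ^ 3) (3 * m + i)
      = qpochhammer x (q ^ 3) m * qpochhammer (x * q ^ (3 * m)) (q ^ 3) (i + 2 * m)"
    using qpochhammer_add[of x "q ^ 3" m "i + 2 * m"] by (simp add: power_mult add.commute)
  ultimately show ?thesis
    by (simp only: mult_ac)
qed

definition reversal_factor :: "'a::field \<Rightarrow> 'a \<Rightarrow> nat \<Rightarrow> nat \<Rightarrow> 'a" where
  "reversal_factor u p i m
    = (- u) ^ m * p ^ (m choose 2) * ((- u / p ^ (i + m)) ^ i * p ^ (i choose 2))"

text \<open>
  After reversal of the first and the third, the three symbols on the left run through
  consecutive segments of the one on the right.
\<close>

lemma qpochhammer_times_reversed:
  fixes u p :: "'a::field"
  assumes "u \<noteq> 0" "p \<noteq> 0"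
  shows "qpochhammer (u / p ^ (i + m)) p i * qpochhammer (p / u) p m * qpochhammer u p m
    = reversal_factor u p i m * qpochhammer (p / (u * p ^ m)) p (i + 2 * m)"
proof -
  have "qpochhammer (p / (u * p ^ m)) p (m + (m + i))
    = qpochhammer (p / (u * p ^ m)) p m
      * (qpochhammer (p / u) p m * qpochhammer (p / u * p ^ m) p i)"
    unfolding qpochhammer_add using assms by simp
  moreover have "m + (m + i) = i + 2 * m" by simp
  moreover have "qpochhammer (u / p ^ (i + m)) p i
      = (- (u / p ^ (i + m))) ^ i * p ^ (i choose 2) * qpochhammer (p / u * p ^ m) p i"
    using qpochhammer_reverse[of "u / p ^ (i + m)" p i] assms by (simp add: power_add mult_ac)
  ultimately show ?thesis
    using qpochhammer_reverse[OF assms, of m] by (simp add: reversal_factor_def mult_ac)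
qed

lemma two_times_choose_two: "2 * int (k choose 2) = int k * (int k - 1)"
  by (induction k) (simp_all add: numeral_2_eq_2 algebra_simps)

definition summand_exponent :: "nat \<Rightarrow> nat \<Rightarrow> nat \<Rightarrow> int" where
  "summand_exponent l n i
    = (((4 + 4 * int n + 6 * int l - 6 * int i) * int i - int n - (int n) ^ 2) div 6)"

lemma summand_exponent_eq:
  assumes "n = i + 3 * m"
  shows "summand_exponent l n i
    = int (l * i + i + n * i) - int (2 * i + (2 + 2 * i) * m + 3 * (m choose 2) + 3 * (i choose 2))"
    (is "_ = int ?a - int ?c")
proof -
  define N where "N = (4 + 4 * int n + 6 * int l - 6 * int i) * int i - int n - (int n)\<^sup>2"
  have "6 * int ?c = 12 * int i + 12 * (1 + int i) * int m
      + 9 * (2 * int (m choose 2)) + 9 * (2 * int (i choose 2))"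
    by (simp add: algebra_simps)
  also have "\<dots> = 6 * int ?a - N"
    unfolding two_times_choose_two N_def assms by (simp add: algebra_simps power2_eq_square)
  finally have "N = 6 * (int ?a - int ?c)" by simp
  then show ?thesis by (simp add: summand_exponent_def flip: N_def)
qed

lemma summand_power_times_reversal_factor:
  fixes q b :: "'a::field"
  assumes "q \<noteq> 0" and n: "n = i + 3 * m"
  defines "u \<equiv> q\<^sup>2 * (b * q ^ (2 * i))"
  shows "(- 1) ^ n * q powi summand_exponent l n i * reversal_factor u (q ^ 3) i m
    = q ^ (l * i) * q ^ i * b ^ (i + m)"
proof -
  define c where "c = 2 * i + (2 + 2 * i) * m + 3 * (m choose 2) + 3 * (i choose 2)"
  have "(q ^ 3) ^ (i + m) = q ^ (2 * i) * q ^ n"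
    unfolding power_mult[symmetric] power_add[symmetric] by (simp add: n)
  then have u_quotient: "- u / (q ^ 3) ^ (i + m) = - (q\<^sup>2 * b / q ^ n)"
    using \<open>q \<noteq> 0\<close> by (simp add: u_def)
  have "reversal_factor u (q ^ 3) i m = (- 1) ^ (i + m) * b ^ (i + m) * q ^ c / q ^ (n * i)"
    unfolding reversal_factor_def u_quotient power_minus[of u] power_minus[of "_ / _"]
    by (simp add: u_def c_def power_add power_mult_distrib power_divide distrib_right mult_ac
        flip: power_mult)
  moreover have "(- 1 :: 'a) ^ n * (- 1) ^ (i + m) = 1"
    by (simp add: n flip: power_add)
  moreover have "q powi summand_exponent l n i = q ^ (l * i + i + n * i) / q ^ c"
    unfolding summand_exponent_eq[OF n] c_def[symmetric]
    using \<open>q \<noteq> 0\<close> by (simp only: power_int_diff power_int_of_nat simp_thms)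
  ultimately show ?thesis
    using \<open>q \<noteq> 0\<close> by (simp add: power_add mult_ac)
qed

lemma reduced_denominator_reversed:
  fixes q b :: "'a::field"
  assumes "q \<noteq> 0" "b \<noteq> 0" and n: "n = i + 3 * m"
  defines "x \<equiv> q powi (1 - 2 * int n) / b" and "u \<equiv> q\<^sup>2 * (b * q ^ (2 * i))"
  shows "cubic_denominator q (q ^ n) b i
      * (qpochhammer (q / (b * q ^ (2 * i))) (q ^ 3) m * qpochhammer u (q ^ 3) m)
    = reversal_factor u (q ^ 3) i m * qpochhammer (x * q ^ (3 * m)) (q ^ 3) (i + 2 * m)"
proof -
  have "u \<noteq> 0" using assms(1,2) by (simp add: u_def)
  have "x = q / (b * (q ^ n)\<^sup>2)"
    using \<open>q \<noteq> 0\<close> by (simp add: x_def power_int_diff power_int_mult mult.commute[of 2])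
  moreover have "q ^ n = q ^ i * (q ^ 3) ^ m"
    by (simp add: n power_add power_mult)
  ultimately have "x * q ^ (3 * m) = q ^ 3 / (u * (q ^ 3) ^ m)"
    using \<open>q \<noteq> 0\<close>
    by (simp add: u_def power_mult power_add mult_2 mult_2_right power2_eq_square power3_eq_cube)
  moreover have "u / (q ^ 3) ^ (i + m) = q\<^sup>2 * b / q ^ n" "q ^ 3 / u = q / (b * q ^ (2 * i))"
    using \<open>q \<noteq> 0\<close>
    by (simp_all add: u_def n power_add power_mult mult_2_right power2_eq_square power3_eq_cube
        power_mult_distrib mult_ac)
  ultimately show ?thesis
    using qpochhammer_times_reversed[OF \<open>u \<noteq> 0\<close> power_not_zero[OF \<open>q \<noteq> 0\<close>], of 3 i m]
    by (simp only: cubic_denominator_def mult.assoc)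
qed

lemma reduced_denominator_eq_prefactor_quotient:
  fixes q b :: "'a::field"
  assumes "q \<noteq> 0" "b \<noteq> 0" and n: "n = i + 3 * m"
  defines "x \<equiv> q powi (1 - 2 * int n) / b"
  assumes nz: "qpochhammer x (q ^ 3) n \<noteq> 0" "qpochhammer (x * q ^ (3 * m)) q i \<noteq> 0"
    "qpochhammer (x * q) (q ^ 3) m \<noteq> 0" "qpochhammer (x * q\<^sup>2) (q ^ 3) m \<noteq> 0"
  shows "q ^ (l * i) * q ^ i
      / (cubic_denominator q (q ^ n) b i
         * (qpochhammer (q / (b * q ^ (2 * i))) (q ^ 3) m
            * qpochhammer (q\<^sup>2 * (b * q ^ (2 * i))) (q ^ 3) m))
    = qpochhammer x q n / qpochhammer x (q ^ 3) n
      * ((- 1) ^ n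
         * (q powi summand_exponent l n i / b ^ (i + m))
         / (qpochhammer (x * q ^ (3 * m)) q i
            * (qpochhammer (x * q) (q ^ 3) m * qpochhammer (x * q\<^sup>2) (q ^ 3) m)))"
    (is "_ = _ / ?\<epsilon> * ((- 1) ^ n * (?\<eta> / _) / ?\<beta>)")
proof -
  define \<mu> where "\<mu> = reversal_factor (q\<^sup>2 * (b * q ^ (2 * i))) (q ^ 3) i m"
  define \<zeta> where "\<zeta> = qpochhammer (x * q ^ (3 * m)) (q ^ 3) (i + 2 * m)"
  have "\<mu> \<noteq> 0" using assms(1,2) by (simp add: \<mu>_def reversal_factor_def)
  have "qpochhammer x (q ^ 3) n = qpochhammer x (q ^ 3) m * \<zeta>"
    using qpochhammer_add[of x "q ^ 3" m "i + 2 * m"] by (simp add: \<zeta>_def n power_mult add_ac)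
  then have "\<zeta> \<noteq> 0" using nz(1) by auto
  have "qpochhammer x q n * \<zeta> = ?\<epsilon> * ?\<beta>"
    using qpochhammer_eq_cubed_times_trisected[of x q m i] by (simp add: \<zeta>_def n add.commute)
  then have prefactor: "qpochhammer x q n / ?\<epsilon> / ?\<beta> = 1 / \<zeta>"
    using nz \<open>\<zeta> \<noteq> 0\<close> by (simp add: field_simps)
  have "(- 1) ^ n * ?\<eta> * \<mu> = q ^ (l * i) * q ^ i * b ^ (i + m)"
    unfolding \<mu>_def by (rule summand_power_times_reversal_factor[OF \<open>q \<noteq> 0\<close> n])
  then have "q ^ (l * i) * q ^ i = (- 1) ^ n * ?\<eta> * \<mu> / b ^ (i + m)"
    using \<open>b \<noteq> 0\<close> by simp
  then have "q ^ (l * i) * q ^ i / (\<mu> * \<zeta>) = (- 1) ^ n * (?\<eta> / b ^ (i + m)) * (1 / \<zeta>)"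
    using \<open>\<mu> \<noteq> 0\<close> by (simp add: mult_ac)
  then show ?thesis
    unfolding reduced_denominator_reversed[OF assms(1-3), folded x_def, folded \<mu>_def \<zeta>_def]
      prefactor[symmetric]
    by (simp add: mult_ac)
qed

lemma qpoch_of_nat: "qpoch x q (int n) = qpochhammer x q n"
proof (induction n)
  case 0
  then show ?case by (simp add: qpoch_def)
next
  case (Suc n)
  have "{0..int (Suc n) - 1} = insert (int n) {0..int n - 1}" by auto
  then show ?case using Suc by (simp add: qpoch_def qpochhammer_Suc mult.commute)
qed

lemma powi_uminus_of_nat: "q powi (- int k) = 1 / q ^ k" for q :: "'a::field"
  by (simp add: power_int_minus inverse_eq_divide)

lemma powi_two_minus_times:
  fixes q b :: "'a::field"
  shows "q \<noteq> 0 \<Longrightarrow> q powi (2 - int n) * b = q\<^sup>2 * b / q ^ n"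
  by (simp add: power_int_diff)

lemma lhs_summand_eq:
  assumes "q \<noteq> 0" "sb ^ 2 = b" "sqb ^ 2 = q * b"
  shows "1 / qpoch (q powi (2 - int n) * b) (q ^ 3) (int k)
        * ((qpoch (q powi (- int n)) q (int k)
            * qpoch sb q (int k) * qpoch (- sb) q (int k)
            * qpoch sqb q (int k) * qpoch (- sqb) q (int k))
           / (qpoch q q (int k) * qpoch (q ^ l * b) q (int k)))
        * q ^ ((1 + l) * k)
    = qpochhammer (1 / q ^ n) q k * q ^ k
       / (cubic_denominator q (q ^ n) b k * qpochhammer q q k
          * qpochhammer (q ^ l * b) q k)
       * ((q ^ l) ^ k * qpochhammer b q (2 * k))"
proof -
  have "q ^ ((1 + l) * k) = q ^ k * (q ^ l) ^ k"
    by (simp add: power_add power_mult)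
  then show ?thesis
    unfolding qpoch_of_nat powi_uminus_of_nat powi_two_minus_times[OF \<open>q \<noteq> 0\<close>]
      qpochhammer_square_roots[OF assms(2,3), symmetric] cubic_denominator_def
    by (simp add: mult_ac)
qed

lemma cubic_sum_reduced_eq_0:
  fixes q b :: "'a::real_normed_field"
  assumes "q \<noteq> 0" "i \<le> n" "\<not> 3 dvd (int n - int i)" "qpochhammer q q n \<noteq> 0"
    and den_nz: "cubic_denominator q (q ^ n) b n \<noteq> 0"
  shows "cubic_sum q (n - i) (b * q ^ (2 * i)) = 0"
proof (rule cubic_sum_eq_0[OF \<open>q \<noteq> 0\<close>])
  show "\<not> 3 dvd (n - i)"
    using assms(2,3) by (simp add: of_nat_diff flip: int_dvd_int_iff)
  show "qpochhammer q q (n - i) \<noteq> 0"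
    using assms(4) by (rule qpochhammer_neq_0_mono) simp
qed (rule cubic_denominator_reduced[OF assms(1,2) den_nz])

lemma reduction_coeff_times_cubic_sum_three_times:
  fixes q b :: "'a::field"
  assumes "q \<noteq> 0" "b \<noteq> 0" "q - b \<noteq> 0" and n: "n = i + 3 * m"
    and qq_nz: "qpochhammer q q n \<noteq> 0" and den_nz: "cubic_denominator q (q ^ n) b n \<noteq> 0"
  shows "reduction_coeff (q ^ l) (q ^ n) b q i * cubic_sum q (3 * m) (b * q ^ (2 * i))
    = (q - q ^ (2 * i) * b) / (q - b)
      * (qpochhammer (1 / q ^ l) q i * qpochhammer (1 / q ^ n) q i * qpochhammer (b / q) q i)
      / (qpochhammer q q i * qpochhammer (q ^ l * b) q i)
      * (qpochhammer q (q ^ 3) m * qpochhammer (q\<^sup>2) (q ^ 3) m)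
      * (q ^ (l * i) * q ^ i
         / (cubic_denominator q (q ^ n) b i
            * (qpochhammer (q / (b * q ^ (2 * i))) (q ^ 3) m
               * qpochhammer (q\<^sup>2 * (b * q ^ (2 * i))) (q ^ 3) m)))"
proof -
  have "cubic_denominator q (q ^ (3 * m)) (b * q ^ (2 * i)) (3 * m) \<noteq> 0"
    using cubic_denominator_reduced[OF \<open>q \<noteq> 0\<close> _ den_nz, of i] by (simp add: n)
  moreover have "qpochhammer q q (3 * m) \<noteq> 0"
    by (rule qpochhammer_neq_0_mono[OF qq_nz]) (simp add: n)
  ultimately have cubic: "cubic_sum q (3 * m) (b * q ^ (2 * i))
      = qpochhammer q (q ^ 3) m * qpochhammer (q\<^sup>2) (q ^ 3) m
        / (qpochhammer (q / (b * q ^ (2 * i))) (q ^ 3) m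
           * qpochhammer (q\<^sup>2 * (b * q ^ (2 * i))) (q ^ 3) m)"
    using assms(1,2) by (intro cubic_sum_three_times) simp_all
  show ?thesis
    unfolding reduction_coeff_def cubic very_well_poised_factor_eq[OF assms(1,3)]
      power_mult[of q l i]
    by (simp add: mult_ac)
qed

lemma reduction_coeff_times_cubic_sum_eq_rhs_summand:
  fixes b q :: complex
  assumes "q \<noteq> 0" "b \<noteq> 0" "i \<le> n"
    and qq_nz: "qpochhammer q q n \<noteq> 0" and den_nz: "cubic_denominator q (q ^ n) b n \<noteq> 0"
    and prefactor_nz: "qpoch (q powi (1 - 2 * int n) / b) (q ^ 3) (int n) \<noteq> 0"
    and summand_nz: "3 dvd (int n - int i) \<Longrightarrow> q - b \<noteq> 0 \<and>
      qpoch (q powi (1 - int n - int i) / b) q (int i) \<noteq> 0 \<and>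
      qpoch (q powi (2 - 2 * int n) / b) (q ^ 3) ((int n - int i) div 3) \<noteq> 0 \<and>
      qpoch (q powi (3 - 2 * int n) / b) (q ^ 3) ((int n - int i) div 3) \<noteq> 0"
  shows "reduction_coeff (q ^ l) (q ^ n) b q i * cubic_sum q (n - i) (b * q ^ (2 * i))
    = qpoch (q powi (1 - 2 * int n) / b) q (int n)
       / qpoch (q powi (1 - 2 * int n) / b) (q ^ 3) (int n)
       * ((- 1) ^ n
           * (q powi (((4 + 4 * int n + 6 * int l - 6 * int i) * int i - int n - (int n) ^ 2) div 6)
              / b powi ((int n + 2 * int i) div 3))
           * ((q - q ^ (2 * i) * b) / (q - b))
           * ((qpoch (q powi (- int l)) q (int i)
               * qpoch (q powi (- int n)) q (int i)
               * qpoch (b / q) q (int i))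
              / (qpoch q q (int i) * qpoch (q ^ l * b) q (int i)
                 * qpoch (q powi (1 - int n - int i) / b) q (int i)))
           * ((qpoch q (q ^ 3) ((int n - int i) div 3)
               * qpoch (q ^ 2) (q ^ 3) ((int n - int i) div 3))
              / (qpoch (q powi (2 - 2 * int n) / b) (q ^ 3) ((int n - int i) div 3)
                 * qpoch (q powi (3 - 2 * int n) / b) (q ^ 3) ((int n - int i) div 3)))
           * chi (int n - int i))"
proof (cases "3 dvd (int n - int i)")
  case False
  then show ?thesis
    using cubic_sum_reduced_eq_0[OF assms(1,3) _ qq_nz den_nz] by (simp add: chi_def)
next
  case True
  then obtain k where "int n - int i = 3 * k" by (rule dvdE)
  with \<open>i \<le> n\<close> obtain m where n: "n = i + 3 * m"
    by (intro that[of "nat k"]) linarith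
  define x where "x = q powi (1 - 2 * int n) / b"
  have div: "(int n - int i) div 3 = int m" "(int n + 2 * int i) div 3 = int (i + m)"
    "chi (int n - int i) = 1"
    by (simp_all add: n chi_def)
  have shift: "q powi j / b = x * q ^ k" if "j = 1 - 2 * int n + int k" for j k
    using \<open>q \<noteq> 0\<close> unfolding that by (simp add: x_def power_int_add)
  have args: "q powi (1 - 2 * int n) / b = x"
    "q powi (1 - int n - int i) / b = x * q ^ (3 * m)"
    "q powi (2 - 2 * int n) / b = x * q" "q powi (3 - 2 * int n) / b = x * q\<^sup>2"
    using x_def shift[of "1 - int n - int i" "3 * m"] shift[of "2 - 2 * int n" 1]
      shift[of "3 - 2 * int n" 2] n by simp_all
  have qb_nz: "q - b \<noteq> 0"
    and nz: "qpochhammer x (q ^ 3) n \<noteq> 0" "qpochhammer (x * q ^ (3 * m)) q i \<noteq> 0"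
    "qpochhammer (x * q) (q ^ 3) m \<noteq> 0" "qpochhammer (x * q\<^sup>2) (q ^ 3) m \<noteq> 0"
    using prefactor_nz summand_nz[OF True] unfolding div(1) args qpoch_of_nat by auto
  have "n - i = 3 * m" by (simp add: n)
  note reduction_coeff_times_cubic_sum_three_times[OF assms(1,2) qb_nz n qq_nz den_nz, of l]
  also note reduced_denominator_eq_prefactor_quotient[OF assms(1,2) n, folded x_def, OF nz, of l]
  finally show ?thesis
    unfolding summand_exponent_def div args qpoch_of_nat power_int_of_nat powi_uminus_of_nat
      \<open>n - i = 3 * m\<close>
    by (simp add: mult_ac)
qed

theorem theorem5:
  fixes l n :: nat and b q sb sqb :: complex
  assumes "b \<noteq> 0" and "q \<noteq> 0"
    and "sb ^ 2 = b" and "sqb ^ 2 = q * b"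
    and lhs_denominators: "\<And>k::nat. k \<le> n \<Longrightarrow>
        qpoch (q powi (2 - int n) * b) (q ^ 3) (int k) \<noteq> 0 \<and>
        qpoch q q (int k) \<noteq> 0 \<and>
        qpoch (q ^ l * b) q (int k) \<noteq> 0"
    and prefactor_denominator: "qpoch (q powi (1 - 2 * int n) / b) (q ^ 3) (int n) \<noteq> 0"
    and rhs_denominators: "\<And>i::nat. i \<le> l \<Longrightarrow> 3 dvd (int n - int i) \<Longrightarrow>
        q - b \<noteq> 0 \<and>
        qpoch q q (int i) \<noteq> 0 \<and>
        qpoch (q ^ l * b) q (int i) \<noteq> 0 \<and>
        qpoch (q powi (1 - int n - int i) / b) q (int i) \<noteq> 0 \<and>
        qpoch_defined q (q ^ 3) ((int n - int i) div 3) \<and>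
        qpoch_defined (q ^ 2) (q ^ 3) ((int n - int i) div 3) \<and>
        qpoch (q powi (2 - 2 * int n) / b) (q ^ 3) ((int n - int i) div 3) \<noteq> 0 \<and>
        qpoch (q powi (3 - 2 * int n) / b) (q ^ 3) ((int n - int i) div 3) \<noteq> 0"
  shows
    "(\<Sum>k = 0..n.
        1 / qpoch (q powi (2 - int n) * b) (q ^ 3) (int k)
        * ((qpoch (q powi (- int n)) q (int k)
            * qpoch sb q (int k) * qpoch (- sb) q (int k)
            * qpoch sqb q (int k) * qpoch (- sqb) q (int k))
           / (qpoch q q (int k) * qpoch (q ^ l * b) q (int k)))
        * q ^ ((1 + l) * k))
     = qpoch (q powi (1 - 2 * int n) / b) q (int n)
       / qpoch (q powi (1 - 2 * int n) / b) (q ^ 3) (int n)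
       * (\<Sum>i = 0..l.
           (- 1) ^ n
           * (q powi (((4 + 4 * int n + 6 * int l - 6 * int i) * int i - int n - (int n) ^ 2) div 6)
              / b powi ((int n + 2 * int i) div 3))
           * ((q - q ^ (2 * i) * b) / (q - b))
           * ((qpoch (q powi (- int l)) q (int i)
               * qpoch (q powi (- int n)) q (int i)
               * qpoch (b / q) q (int i))
              / (qpoch q q (int i) * qpoch (q ^ l * b) q (int i)
                 * qpoch (q powi (1 - int n - int i) / b) q (int i)))
           * ((qpoch q (q ^ 3) ((int n - int i) div 3)
               * qpoch (q ^ 2) (q ^ 3) ((int n - int i) div 3))
              / (qpoch (q powi (2 - 2 * int n) / b) (q ^ 3) ((int n - int i) div 3)
                 * qpoch (q powi (3 - 2 * int n) / b) (q ^ 3) ((int n - int i) div 3)))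
           * chi (int n - int i))"
    (is "?L = ?P * (\<Sum>i = 0..l. ?R i)")
proof -
  have den_nz: "cubic_denominator q (q ^ n) b n \<noteq> 0" and qq_nz: "qpochhammer q q n \<noteq> 0"
    and Xb_nz: "qpochhammer (q ^ l * b) q n \<noteq> 0"
    using lhs_denominators[of n]
    by (auto simp: qpoch_of_nat cubic_denominator_def powi_two_minus_times[OF \<open>q \<noteq> 0\<close>])
  define reduced where
    "reduced = (\<lambda>i. reduction_coeff (q ^ l) (q ^ n) b q i * cubic_sum q (n - i) (b * q ^ (2 * i)))"
  have "?L = (\<Sum>i\<le>n. reduced i)"
    unfolding atLeast0AtMost lhs_summand_eq[OF \<open>q \<noteq> 0\<close> assms(3,4)] reduced_def
    using \<open>q \<noteq> 0\<close> by (intro sum_reduction_cubic_sum qq_nz Xb_nz) simp_all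
  also have "\<dots> = (\<Sum>i = 0..l. ?P * ?R i)"
  proof (rule sum.mono_neutral_cong)
    show "reduced i = 0" if "i \<in> {..n} - {0..l}" for i
      using that \<open>q \<noteq> 0\<close>
      by (simp add: reduced_def reduction_coeff_def qpochhammer_inverse_power_eq_0)
    show "?P * ?R i = 0" if "i \<in> {0..l} - {..n}" for i
      using that \<open>q \<noteq> 0\<close>
      by (simp add: powi_uminus_of_nat qpoch_of_nat qpochhammer_inverse_power_eq_0)
    show "reduced i = ?P * ?R i" if "i \<in> {..n} \<inter> {0..l}" for i
      unfolding reduced_def
      using that assms(1,2) rhs_denominators[of i]
      by (intro reduction_coeff_times_cubic_sum_eq_rhs_summand qq_nz den_nz
          prefactor_denominator) auto
  qed simp_all
  finally show ?thesis by (simp only: sum_distrib_left)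
qed

end
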